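(* Let $V$ be an infinite-dimensional Banach space and let $E$ be a standard Banach sequence space. Then the set \[ \mathcal{I}=\{T\colon V\to E : T \text{ is linear, continuous and injective}\} \] is either empty or spaceable in $\mathcal{L}(V;E)$.
   Context: All vector spaces are over a fixed scalar field $\mathbb{K}$, which is either $\mathbb{R}$ or $\mathbb{C}$. For Banach spaces $V,E$, $\mathcal{L}(V;E)$ is the Banach space of all continuous linear operators $V\to E$ with the operator norm. Spaceable: a subset $A$ of a topological vector space $Z$ is spaceable in $Z$ if $A\cup\{0\}$ contains a closed infinite-dimensional linear subspace of $Z$. Standard Banach sequence space: let $X\neq\{0\}$ be a Banach space over $\mathbb{K}$. A standard Banach sequence space over $X$ is an infinite-dimensional Banach space $E$ whose elements are $X$-valued sequences $x=(x_j)_{j=1}^\infty$ (with coordinatewise linear operations) such that: (i) there is $C>0$ such that $\|x_j\|_X\le C\|x\|_E$ for every $x=(x_j)_{j=1}^\infty\in E$ and all $j\in\mathbb{N}$; (ii) if $x=(x_j)_{j=1}^\infty\in E$ and $(x_{n_k})_{k=1}^\infty$ is a subsequence of $x$, then $(x_{n_k})_{k=1}^\infty\in E$ and $\|(x_{n_k})_{k=1}^\infty\|_E\le\|x\|_E$; (iii) if $(x_j)_{j=1}^\infty\in E$ and $\{n_1<n_2<n_3<\cdots\}$ is an infinite subset of $\mathbb{N}$, then the sequence $(y_j)_{j=1}^\infty$ defined by $y_j=x_i$ if $j=n_i$, and $y_j=0$ otherwise, belongs to $E$ and $\|(y_j)_{j=1}^\infty\|_E\le\|(x_j)_{j=1}^\infty\|_E$.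 A standard Banach sequence space is a standard Banach sequence space over some Banach space $X\ne\{0\}$. *)

theory Defs
  imports "HOL-Analysis.Analysis" "HOL-Library.Function_Algebras"
begin

section \<open>Scalars and Banach spaces\<close>

text \<open>The scalar field is a type that is, up to an isometric field isomorphism, the field of
  real numbers or the field of complex numbers.\<close>

class real_or_complex = real_normed_field +
  assumes real_or_complex:
    "(\<exists>\<phi> :: 'a \<Rightarrow> real. bij \<phi> \<and> (\<forall>x y. \<phi> (x + y) = \<phi> x + \<phi> y) \<and>
        (\<forall>x y. \<phi> (x * y) = \<phi> x * \<phi> y) \<and> (\<forall>x. norm (\<phi> x) = norm x)) \<or>
     (\<exists>\<phi> :: 'a \<Rightarrow> complex. bij \<phi> \<and> (\<forall>x y. \<phi> (x + y) = \<phi> x + \<phi> y) \<and>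
        (\<forall>x y. \<phi> (x * y) = \<phi> x * \<phi> y) \<and> (\<forall>x. norm (\<phi> x) = norm x))"

instance real :: real_or_complex
  by standard (rule disjI1, rule exI[of _ "\<lambda>x. x"], auto intro: bij_id[unfolded id_def])

instance complex :: real_or_complex
  by standard (rule disjI2, rule exI[of _ "\<lambda>x. x"], auto intro: bij_id[unfolded id_def])

text \<open>A Banach space over the scalar field. The class \<^class>\<open>banach\<close> supplies addition and the
  complete norm (its real scalar multiplication is necessarily the restriction of \<open>smul\<close>).\<close>

locale banach_space_over = vector_space smul
  for smul :: "'k::real_or_complex \<Rightarrow> 'v::banach \<Rightarrow> 'v" +
  assumes norm_scale: "norm (smul a x) = norm a * norm x"

definition infinite_dimensional ::
  "('k::field \<Rightarrow> 'v::ab_group_add \<Rightarrow> 'v) \<Rightarrow> 'v set \<Rightarrow> bool" where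
  "infinite_dimensional smul W \<longleftrightarrow> \<not> (\<exists>B. finite B \<and> W \<subseteq> module.span smul B)"

text \<open>Pointwise scalar multiplication, complementing the pointwise addition of
  \<^theory>\<open>HOL-Library.Function_Algebras\<close>.\<close>

definition fun_scale :: "('k \<Rightarrow> 'v \<Rightarrow> 'v) \<Rightarrow> 'k \<Rightarrow> ('i \<Rightarrow> 'v) \<Rightarrow> 'i \<Rightarrow> 'v" where
  "fun_scale smul a f = (\<lambda>i. smul a (f i))"

lemma vector_space_fun_scale:
  assumes "vector_space smul"
  shows "vector_space (fun_scale smul)"
proof -
  interpret vector_space smul by fact
  show ?thesis
    by unfold_locales
      (auto simp: fun_scale_def fun_eq_iff scale_right_distrib scale_left_distrib)
qed

text \<open>Spaceability in the topological vector space with carrier \<open>topspace Z\<close>, topology \<open>Z\<close> and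
  scalar multiplication \<open>smul\<close>.\<close>

definition spaceable ::
  "('k::field \<Rightarrow> 'z::ab_group_add \<Rightarrow> 'z) \<Rightarrow> 'z topology \<Rightarrow> 'z set \<Rightarrow> bool" where
  "spaceable smul Z A \<longleftrightarrow>
     (\<exists>W. W \<subseteq> A \<union> {0} \<and> module.subspace smul W \<and> closedin Z W \<and> infinite_dimensional smul W)"


section \<open>Normed spaces given by a carrier\<close>

text \<open>A linear subspace \<open>M\<close> of an ambient vector space, with a norm of its own; the values of
  \<open>nrm\<close> off \<open>M\<close> are irrelevant.\<close>

locale normed_subspace = vector_space smul
  for smul :: "'k::real_normed_field \<Rightarrow> 'z::ab_group_add \<Rightarrow> 'z" +
  fixes M :: "'z set" and nrm :: "'z \<Rightarrow> real"
  assumes subspace_M: "subspace M"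
    and nrm_nonneg: "x \<in> M \<Longrightarrow> 0 \<le> nrm x"
    and nrm_eq_0: "x \<in> M \<Longrightarrow> nrm x = 0 \<longleftrightarrow> x = 0"
    and nrm_triangle: "x \<in> M \<Longrightarrow> y \<in> M \<Longrightarrow> nrm (x + y) \<le> nrm x + nrm y"
    and nrm_scale: "x \<in> M \<Longrightarrow> nrm (smul a x) = norm a * nrm x"

text \<open>\<^locale>\<open>Metric_space\<close> asks for nonnegativity and symmetry also off the carrier, hence the
  default value.\<close>

definition norm_dist :: "'z::ab_group_add set \<Rightarrow> ('z \<Rightarrow> real) \<Rightarrow> 'z \<Rightarrow> 'z \<Rightarrow> real" where
  "norm_dist M nrm x y = (if x \<in> M \<and> y \<in> M then nrm (x - y) else 0)"

definition norm_topology :: "'z::ab_group_add set \<Rightarrow> ('z \<Rightarrow> real) \<Rightarrow> 'z topology" where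
  "norm_topology M nrm = Metric_space.mtopology M (norm_dist M nrm)"

lemma (in normed_subspace) Metric_space_norm_dist: "Metric_space M (norm_dist M nrm)"
proof
  have diff: "x - y \<in> M" if "x \<in> M" "y \<in> M" for x y
    using subspace_diff[OF subspace_M that] .
  fix x y :: 'z
  show "0 \<le> norm_dist M nrm x y"
    by (simp add: norm_dist_def nrm_nonneg diff)
  show "norm_dist M nrm x y = norm_dist M nrm y x"
    using nrm_scale[of "x - y" "- 1"] diff by (simp add: norm_dist_def)
  show "norm_dist M nrm x y = 0 \<longleftrightarrow> x = y" if "x \<in> M" "y \<in> M"
    using that nrm_eq_0[OF diff[OF that]] by (simp add: norm_dist_def)
  fix z
  show "norm_dist M nrm x z \<le> norm_dist M nrm x y + norm_dist M nrm y z"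
    if "x \<in> M" "y \<in> M" "z \<in> M"
    using that nrm_triangle[OF diff[of x y] diff[of y z]] by (simp add: norm_dist_def)
qed


section \<open>Standard Banach sequence spaces\<close>

text \<open>A Banach space \<open>E\<close> whose elements are \<open>X\<close>-valued sequences, where \<open>X\<close> is the whole
  type \<^typ>\<open>'x\<close>.\<close>

locale banach_seq_space =
  X: banach_space_over smul + normed_subspace "fun_scale smul" E nrm
  for smul :: "'k::real_or_complex \<Rightarrow> 'x::banach \<Rightarrow> 'x"
    and E :: "(nat \<Rightarrow> 'x) set" and nrm :: "(nat \<Rightarrow> 'x) \<Rightarrow> real" +
  assumes complete_E: "Metric_space.mcomplete E (norm_dist E nrm)"

text \<open>The sequence with \<open>y (n i) = x i\<close> that vanishes off the range of the injective map \<open>n\<close>.\<close>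

definition spread :: "(nat \<Rightarrow> nat) \<Rightarrow> (nat \<Rightarrow> 'x::zero) \<Rightarrow> nat \<Rightarrow> 'x" where
  "spread n x j = (if j \<in> range n then x (inv n j) else 0)"

locale standard_banach_seq_space = banach_seq_space smul E nrm
  for smul :: "'k::real_or_complex \<Rightarrow> 'x::banach \<Rightarrow> 'x"
    and E :: "(nat \<Rightarrow> 'x) set" and nrm :: "(nat \<Rightarrow> 'x) \<Rightarrow> real" +
  assumes X_nontrivial: "\<exists>v :: 'x. v \<noteq> 0"
    and infinite_dimensional_E: "infinite_dimensional (fun_scale smul) E"
    and coordinate_bound: "\<exists>C>0. \<forall>x\<in>E. \<forall>j. norm (x j) \<le> C * nrm x"
    and subseq_closed:
      "x \<in> E \<Longrightarrow> strict_mono n \<Longrightarrow> (x \<circ> n) \<in> E \<and> nrm (x \<circ> n) \<le> nrm x"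
    and spread_closed:
      "x \<in> E \<Longrightarrow> strict_mono n \<Longrightarrow> spread n x \<in> E \<and> nrm (spread n x) \<le> nrm x"


section \<open>Continuous linear operators into a sequence space\<close>

definition continuous_operators ::
  "('k::field \<Rightarrow> 'v::real_normed_vector \<Rightarrow> 'v) \<Rightarrow> ('k \<Rightarrow> 'x::ab_group_add \<Rightarrow> 'x)
    \<Rightarrow> (nat \<Rightarrow> 'x) set \<Rightarrow> ((nat \<Rightarrow> 'x) \<Rightarrow> real) \<Rightarrow> ('v \<Rightarrow> nat \<Rightarrow> 'x) set" where
  "continuous_operators scaleV scaleX E nrm =
     {T. Vector_Spaces.linear scaleV (fun_scale scaleX) T \<and>
         continuous_map euclidean (norm_topology E nrm) T}"

definition operator_norm ::
  "((nat \<Rightarrow> 'x) \<Rightarrow> real) \<Rightarrow> ('v::real_normed_vector \<Rightarrow> nat \<Rightarrow> 'x) \<Rightarrow> real" where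
  "operator_norm nrm T = (SUP v\<in>cball 0 1. nrm (T v))"

definition operator_topology ::
  "('k::field \<Rightarrow> 'v::real_normed_vector \<Rightarrow> 'v) \<Rightarrow> ('k \<Rightarrow> 'x::ab_group_add \<Rightarrow> 'x)
    \<Rightarrow> (nat \<Rightarrow> 'x) set \<Rightarrow> ((nat \<Rightarrow> 'x) \<Rightarrow> real) \<Rightarrow> ('v \<Rightarrow> nat \<Rightarrow> 'x) topology" where
  "operator_topology scaleV scaleX E nrm =
     norm_topology (continuous_operators scaleV scaleX E nrm) (operator_norm nrm)"

definition injective_operators ::
  "('k::field \<Rightarrow> 'v::real_normed_vector \<Rightarrow> 'v) \<Rightarrow> ('k \<Rightarrow> 'x::ab_group_add \<Rightarrow> 'x)
    \<Rightarrow> (nat \<Rightarrow> 'x) set \<Rightarrow> ((nat \<Rightarrow> 'x) \<Rightarrow> real) \<Rightarrow> ('v \<Rightarrow> nat \<Rightarrow> 'x) set" where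
  "injective_operators scaleV scaleX E nrm =
     {T \<in> continuous_operators scaleV scaleX E nrm. inj T}"


text \<open>The continuous operators with the operator norm form a normed space; in particular the
  suprema in \<^const>\<open>operator_norm\<close> are finite.\<close>

locale operators_into_seq_space =
  V: banach_space_over scaleV + E: banach_seq_space scaleX E nrm
  for scaleV :: "'k::real_or_complex \<Rightarrow> 'v::banach \<Rightarrow> 'v"
    and scaleX :: "'k \<Rightarrow> 'x::banach \<Rightarrow> 'x"
    and E :: "(nat \<Rightarrow> 'x) set" and nrm :: "(nat \<Rightarrow> 'x) \<Rightarrow> real"
begin

interpretation ME: Metric_space E "norm_dist E nrm"
  by (rule E.Metric_space_norm_dist)

abbreviation "L \<equiv> continuous_operators scaleV scaleX E nrm"

lemma operator_linear: "T \<in> L \<Longrightarrow> Vector_Spaces.linear scaleV (fun_scale scaleX) T"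
  by (simp add: continuous_operators_def)

lemma operator_in_E: "T \<in> L \<Longrightarrow> T v \<in> E"
  unfolding continuous_operators_def norm_topology_def continuous_map_def by auto

lemma operator_bounded:
  assumes T: "T \<in> L"
  obtains B where "B > 0" "\<And>v. nrm (T v) \<le> B * norm v"
proof -
  interpret T: Vector_Spaces.linear scaleV "fun_scale scaleX" T
    using T by (rule operator_linear)
  have cont: "continuous_map euclidean ME.mtopology T"
    using T by (simp add: continuous_operators_def norm_topology_def)
  have "openin euclidean {v \<in> topspace euclidean. T v \<in> ME.mball 0 1}"
    by (rule openin_continuous_map_preimage[OF cont ME.openin_mball])
  then have "open {v. T v \<in> ME.mball 0 1}" by simp
  moreover have "0 \<in> {v. T v \<in> ME.mball 0 1}"
    using E.subspace_0[OF E.subspace_M] by (simp add: T.zero)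
  ultimately obtain e where e: "e > 0" "ball 0 e \<subseteq> {v. T v \<in> ME.mball 0 1}"
    by (rule openE)
  have small: "nrm (T v) < 1" if "norm v < e" for v
  proof -
    have "T v \<in> ME.mball 0 1" using e(2) that by auto
    then have "norm_dist E nrm (T v) 0 < 1" "T v \<in> E"
      by (auto simp: ME.commute)
    then show ?thesis using E.subspace_0[OF E.subspace_M] by (simp add: norm_dist_def)
  qed
  have "nrm (T v) \<le> 2 / e * norm v" for v
  proof (cases "v = 0")
    case True
    then show ?thesis
      using E.nrm_eq_0[OF E.subspace_0[OF E.subspace_M]] by (simp add: T.zero)
  next
    case False
    define c where "c = e / (2 * norm v)"
    have c: "c > 0" using False e(1) by (simp add: c_def)
    have "norm (scaleV (of_real c) v) = c * norm v"
      using c by (simp add: V.norm_scale)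
    then have "norm (scaleV (of_real c) v) < e"
      using e(1) False by (simp add: c_def)
    then have "nrm (T (scaleV (of_real c) v)) < 1" by (rule small)
    then have "c * nrm (T v) < 1"
      using c E.nrm_scale[OF operator_in_E[OF T]] by (simp add: T.scale)
    then show ?thesis using c False e(1) by (simp add: c_def field_simps)
  qed
  with e(1) show thesis by (intro that[of "2 / e"]) auto
qed

lemma operator_norm_bdd: "T \<in> L \<Longrightarrow> bdd_above ((\<lambda>v. nrm (T v)) ` cball 0 1)"
proof -
  assume "T \<in> L"
  then obtain B where B: "B > 0" "\<And>v. nrm (T v) \<le> B * norm v"
    using operator_bounded by blast
  have "nrm (T v) \<le> B" if "v \<in> cball 0 1" for v
    using order_trans[OF B(2)[of v] mult_left_mono[of "norm v" 1 B]] B(1) that by simp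
  then show ?thesis by (rule bdd_aboveI2)
qed

lemma operator_norm_upper: "T \<in> L \<Longrightarrow> norm v \<le> 1 \<Longrightarrow> nrm (T v) \<le> operator_norm nrm T"
  unfolding operator_norm_def by (rule cSUP_upper) (auto simp: operator_norm_bdd)

lemma operator_norm_least: "(\<And>v. norm v \<le> 1 \<Longrightarrow> nrm (T v) \<le> b) \<Longrightarrow> operator_norm nrm T \<le> b"
  unfolding operator_norm_def by (rule cSUP_least) auto

lemma operatorI:
  assumes T: "Vector_Spaces.linear scaleV (fun_scale scaleX) T" and E: "\<And>v. T v \<in> E"
    and B: "\<And>v. nrm (T v) \<le> B * norm v"
  shows "T \<in> L"
proof -
  interpret T: Vector_Spaces.linear scaleV "fun_scale scaleX" T by fact
  have "\<exists>d>0. \<forall>y. dist x y < d \<longrightarrow> norm_dist E nrm (T x) (T y) < e" if "e > 0" for x e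
  proof (intro exI conjI allI impI)
    show "e / (\<bar>B\<bar> + 1) > 0" using that by simp
    fix y assume "dist x y < e / (\<bar>B\<bar> + 1)"
    then have d: "norm (x - y) * (\<bar>B\<bar> + 1) < e"
      by (simp add: dist_norm pos_less_divide_eq add_pos_nonneg)
    have "norm_dist E nrm (T x) (T y) = nrm (T (x - y))"
      by (simp add: norm_dist_def E T.diff)
    also have "\<dots> \<le> B * norm (x - y)" by (rule B)
    also have "\<dots> \<le> (\<bar>B\<bar> + 1) * norm (x - y)" by (rule mult_right_mono) auto
    finally show "norm_dist E nrm (T x) (T y) < e" using d by (simp add: mult.commute)
  qed
  then have "continuous_map Met_TC.mtopology ME.mtopology T"
    using E by (subst Met_TC.metric_continuous_map[OF ME.Metric_space_axioms])
      (auto simp: dist_commute)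
  then show ?thesis using T by (simp add: continuous_operators_def norm_topology_def)
qed

theorem normed_space_operators:
  "normed_subspace (fun_scale (fun_scale scaleX)) L (operator_norm nrm)"
proof -
  interpret F: vector_space "fun_scale (fun_scale scaleX) :: 'k \<Rightarrow> ('v \<Rightarrow> nat \<Rightarrow> 'x) \<Rightarrow> _"
    by (rule vector_space_fun_scale) (rule E.vector_space_axioms)
  have E0: "0 \<in> E" using E.subspace_0[OF E.subspace_M] .
  have nrm0: "nrm 0 = 0" using E.nrm_eq_0[OF E0] by simp
  have vs: "vector_space_pair scaleV (fun_scale scaleX :: 'k \<Rightarrow> (nat \<Rightarrow> 'x) \<Rightarrow> _)"
    by (simp add: vector_space_pair_def V.vector_space_axioms E.vector_space_axioms)
  interpret P: vector_space_pair scaleV "fun_scale scaleX :: 'k \<Rightarrow> (nat \<Rightarrow> 'x) \<Rightarrow> _" by (rule vs)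
  have zero: "0 \<in> L"
    by (rule operatorI[where B=0])
      (simp_all add: E0 nrm0 P.linear_zero[folded zero_fun_def])
  have add: "S + T \<in> L" if S: "S \<in> L" and T: "T \<in> L" for S T
  proof -
    obtain A where A: "\<And>v. nrm (S v) \<le> A * norm v" using operator_bounded[OF S] by metis
    obtain B where B: "\<And>v. nrm (T v) \<le> B * norm v" using operator_bounded[OF T] by metis
    show ?thesis
    proof (rule operatorI[where B="A + B"])
      show "Vector_Spaces.linear scaleV (fun_scale scaleX) (S + T)"
        using P.linear_compose_add[OF operator_linear[OF S] operator_linear[OF T]]
        by (simp add: plus_fun_def)
      fix v
      show "(S + T) v \<in> E"
        using E.subspace_add[OF E.subspace_M operator_in_E[OF S] operator_in_E[OF T]] by simp
      show "nrm ((S + T) v) \<le> (A + B) * norm v"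
        using E.nrm_triangle[OF operator_in_E[OF S, of v] operator_in_E[OF T, of v]] A[of v] B[of v]
        by (simp add: distrib_right)
    qed
  qed
  have scl: "fun_scale (fun_scale scaleX) a T \<in> L" if T: "T \<in> L" for a T
  proof -
    obtain B where B: "\<And>v. nrm (T v) \<le> B * norm v" using operator_bounded[OF T] by metis
    show ?thesis
    proof (rule operatorI[where B="norm a * B"])
      show "Vector_Spaces.linear scaleV (fun_scale scaleX) (fun_scale (fun_scale scaleX) a T)"
        using P.linear_compose_scale_right[OF operator_linear[OF T]]
        by (simp add: fun_scale_def[of "fun_scale scaleX"])
      fix v
      show "fun_scale (fun_scale scaleX) a T v \<in> E"
        using E.subspace_scale[OF E.subspace_M operator_in_E[OF T]]
        by (simp add: fun_scale_def[of "fun_scale scaleX"])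
      show "nrm (fun_scale (fun_scale scaleX) a T v) \<le> norm a * B * norm v"
        using E.nrm_scale[OF operator_in_E[OF T]] mult_left_mono[OF B, of "norm a" v]
        by (simp add: fun_scale_def[of "fun_scale scaleX"] mult.assoc)
    qed
  qed
  have scl_nrm: "nrm (fun_scale (fun_scale scaleX) a T v) = norm a * nrm (T v)"
    if "T \<in> L" for a T v
    using E.nrm_scale[OF operator_in_E[OF that]] by (simp add: fun_scale_def[of "fun_scale scaleX"])
  show ?thesis
  proof
    show "F.subspace L" using zero add scl by (simp add: F.subspace_def)
    fix S T :: "'v \<Rightarrow> nat \<Rightarrow> 'x" and a :: 'k
    assume S: "S \<in> L"
    have S0: "S 0 = 0"
      using P.linear_0[OF operator_linear[OF S]] .
    show nonneg: "0 \<le> operator_norm nrm S"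
      using operator_norm_upper[OF S, of 0] by (simp add: S0 nrm0)
    show "operator_norm nrm S = 0 \<longleftrightarrow> S = 0"
    proof
      assume "operator_norm nrm S = 0"
      then have unit: "S v = 0" if "norm v \<le> 1" for v
        using operator_norm_upper[OF S that] E.nrm_nonneg[OF operator_in_E[OF S, of v]]
          E.nrm_eq_0[OF operator_in_E[OF S, of v]] by simp
      have "S v = 0" for v
      proof (cases "v = 0")
        case False
        define c where "c = (of_real (inverse (norm v)) :: 'k)"
        have c: "c \<noteq> 0" using False by (simp add: c_def)
        have "S (scaleV c v) = 0"
          by (rule unit) (use False in \<open>simp add: V.norm_scale c_def norm_inverse\<close>)
        then have "fun_scale scaleX c (S v) = 0"
          using P.linear_scale[OF operator_linear[OF S]] by simp
        then show ?thesis using c E.scale_eq_0_iff by blast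
      qed (simp add: S0)
      then show "S = 0" by (simp add: fun_eq_iff)
    next
      assume "S = 0" then show "operator_norm nrm S = 0"
        by (simp add: operator_norm_def nrm0)
    qed
    show "operator_norm nrm (fun_scale (fun_scale scaleX) a S) = norm a * operator_norm nrm S"
    proof (rule antisym)
      show le: "operator_norm nrm (fun_scale (fun_scale scaleX) a S) \<le> norm a * operator_norm nrm S"
        by (rule operator_norm_least)
          (simp add: scl_nrm[OF S] mult_left_mono operator_norm_upper[OF S])
      show "norm a * operator_norm nrm S \<le> operator_norm nrm (fun_scale (fun_scale scaleX) a S)"
      proof (cases "a = 0")
        case True
        then show ?thesis
          using operator_norm_upper[OF scl[OF S], of 0 a] by (simp add: S0 nrm0 scl_nrm[OF S])
      next
        case False
        have "operator_norm nrm S \<le> operator_norm nrm (fun_scale (fun_scale scaleX) a S) / norm a"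
        proof (rule operator_norm_least)
          fix v :: 'v assume "norm v \<le> 1"
          from operator_norm_upper[OF scl[OF S] this, of a]
          show "nrm (S v) \<le> operator_norm nrm (fun_scale (fun_scale scaleX) a S) / norm a"
            using False by (simp add: scl_nrm[OF S] field_simps)
        qed
        then show ?thesis using False by (simp add: field_simps)
      qed
    qed
    assume T: "T \<in> L"
    show "operator_norm nrm (S + T) \<le> operator_norm nrm S + operator_norm nrm T"
    proof (rule operator_norm_least)
      fix v :: 'v assume v: "norm v \<le> 1"
      show "nrm ((S + T) v) \<le> operator_norm nrm S + operator_norm nrm T"
        using E.nrm_triangle[OF operator_in_E[OF S, of v] operator_in_E[OF T, of v]]
          operator_norm_upper[OF S v] operator_norm_upper[OF T v] by simp
    qed
  qed
qed

end

end

theory Submission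
  imports Defs
begin

text \<open>Let \<open>T\<close> be an injective operator. Cut \<open>\<nat>\<close> into infinitely many infinite blocks, the \<open>i\<close>-th
  one enumerated increasingly by \<open>k \<mapsto> prod_encode (i, k)\<close>, and let \<open>W\<close> be the set of all continuous
  operators whose restriction to each block, reindexed by \<open>k\<close>, is a scalar multiple of \<open>T\<close>.
  Three observations make \<open>W\<close> a witness of spaceability.

  A nonzero \<open>R \<in> W\<close> is injective: the blocks exhaust \<open>\<nat>\<close>, so on some block \<open>R\<close> is a \<^emph>\<open>nonzero\<close>
  multiple of \<open>T\<close>, and that block alone determines the argument
  (\<open>block_multiples_injective\<close>).

  \<open>W\<close> is closed: convergence in operator norm implies convergence of every coordinate, and since the
  scalar field is complete, a coordinatewise limit of multiples of \<open>T\<close> is a multiple of \<open>T\<close>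
  (\<open>limit_of_multiples\<close>, \<open>closedin_block_multiples\<close>).

  \<open>W\<close> is infinite-dimensional: it contains the copies of \<open>T\<close> that live on a single block, and these
  have disjoint supports (\<open>infinite_dimensional_block_multiples\<close>). The spreading axiom of a standard
  sequence space is what makes these copies continuous operators into \<open>E\<close>.\<close>

section \<open>Limits of scalar multiples\<close>

text \<open>This gives completeness of the scalar field, which is isometrically isomorphic to the real or
  to the complex numbers: the isomorphism carries Cauchy sequences over and limits back.\<close>

lemma convergent_via_additive_isometry:
  fixes \<phi> :: "'a::real_normed_vector \<Rightarrow> 'b::banach" and a :: "nat \<Rightarrow> 'a"
  assumes "bij \<phi>" and add: "\<forall>x y. \<phi> (x + y) = \<phi> x + \<phi> y" and iso: "\<forall>x. norm (\<phi> x) = norm x"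
    and "Cauchy a"
  shows "convergent a"
proof -
  have "\<phi> (x - y) + \<phi> y = \<phi> x" for x y
    using add[rule_format, of "x - y" y] by simp
  then have diff: "\<phi> x - \<phi> y = \<phi> (x - y)" for x y
    by (simp add: diff_eq_eq)
  have dist: "dist (\<phi> x) (\<phi> y) = dist x y" for x y
    using iso by (simp add: dist_norm diff)
  have "Cauchy (\<lambda>m. \<phi> (a m))"
    using \<open>Cauchy a\<close> by (simp add: Cauchy_def dist)
  then obtain l where "(\<lambda>m. \<phi> (a m)) \<longlonglongrightarrow> l"
    using Cauchy_convergent_iff convergent_def by blast
  moreover obtain b where "l = \<phi> b"
    using \<open>bij \<phi>\<close> by (metis bij_pointE)
  ultimately have "a \<longlonglongrightarrow> b"
    by (simp add: tendsto_iff dist)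
  then show ?thesis by (rule convergentI)
qed

lemma Cauchy_convergent_real_or_complex:
  fixes a :: "nat \<Rightarrow> 'k::real_or_complex"
  assumes "Cauchy a"
  shows "convergent a"
  using real_or_complex[where 'a='k]
proof (elim disjE exE conjE)
  fix \<phi> :: "'k \<Rightarrow> real"
  assume "bij \<phi>" "\<forall>x y. \<phi> (x + y) = \<phi> x + \<phi> y" "\<forall>x. norm (\<phi> x) = norm x"
  then show ?thesis using assms by (rule convergent_via_additive_isometry)
next
  fix \<phi> :: "'k \<Rightarrow> complex"
  assume "bij \<phi>" "\<forall>x y. \<phi> (x + y) = \<phi> x + \<phi> y" "\<forall>x. norm (\<phi> x) = norm x"
  then show ?thesis using assms by (rule convergent_via_additive_isometry)
qed

context banach_space_over
begin

lemma tendsto_scale_left: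
  assumes "a \<longlonglongrightarrow> b"
  shows "(\<lambda>m. smul (a m) x) \<longlonglongrightarrow> smul b x"
proof -
  have "(\<lambda>m. norm (a m - b) * norm x) \<longlonglongrightarrow> 0"
    using tendsto_mult_left_zero[OF tendsto_norm_zero[OF LIM_zero[OF assms]]] .
  then have "(\<lambda>m. norm (smul (a m) x - smul b x)) \<longlonglongrightarrow> 0"
    by (simp add: norm_scale flip: scale_left_diff_distrib)
  then show ?thesis
    by (simp add: LIM_zero_iff tendsto_norm_zero_iff)
qed

text \<open>The multiples of a family \<open>g\<close> form a line, which is closed for pointwise convergence: wherever
  \<open>g\<close> does not vanish, convergence of \<open>a m \<cdot> g\<close> forces the scalars \<open>a m\<close> to be Cauchy.\<close>

lemma limit_of_multiples:
  assumes lim: "\<And>i. (\<lambda>m. smul (a m) (g i)) \<longlonglongrightarrow> h i"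
  shows "\<exists>b. \<forall>i. h i = smul b (g i)"
proof (cases "\<exists>i. g i \<noteq> 0")
  case False
  then have "h i = 0" for i
    using LIMSEQ_unique[OF lim[of i]] by simp
  with False show ?thesis by simp
next
  case True
  then obtain i where i: "norm (g i) > 0" by auto
  have "Cauchy a"
  proof (rule metric_CauchyI)
    fix e :: real assume "e > 0"
    with i have "e * norm (g i) > 0" by simp
    then obtain M where M: "\<And>m n. m \<ge> M \<Longrightarrow> n \<ge> M \<Longrightarrow>
        dist (smul (a m) (g i)) (smul (a n) (g i)) < e * norm (g i)"
      using metric_CauchyD[OF LIMSEQ_imp_Cauchy[OF lim[of i]]] by blast
    have "dist (a m) (a n) < e" if "m \<ge> M" "n \<ge> M" for m n
      using M[OF that] i by (simp add: dist_norm norm_scale flip: scale_left_diff_distrib)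
    then show "\<exists>M. \<forall>m\<ge>M. \<forall>n\<ge>M. dist (a m) (a n) < e" by blast
  qed
  then obtain b where "a \<longlonglongrightarrow> b"
    using Cauchy_convergent_real_or_complex convergent_def by blast
  then have "h i = smul b (g i)" for i
    using LIMSEQ_unique[OF lim tendsto_scale_left] by blast
  then show ?thesis by blast
qed

end

section \<open>Spreading sequences over blocks\<close>

lemma spread_on_range: "inj n \<Longrightarrow> spread n x (n k) = x k"
  by (simp add: spread_def)

lemma spread_off_range: "j \<notin> range n \<Longrightarrow> spread n x j = 0"
  by (simp add: spread_def)

lemma strict_mono_prod_encode: "strict_mono (\<lambda>k. prod_encode (i, k))"
  by (simp add: strict_mono_Suc_iff prod_encode_def)

lemma spread_prod_encode:
  "spread (\<lambda>k. prod_encode (i, k)) x (prod_encode (l, k)) = (if l = i then x k else 0)"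
proof (cases "l = i")
  case True
  then show ?thesis
    using spread_on_range[of "\<lambda>k. prod_encode (i, k)" x k] by (simp add: inj_on_def)
next
  case False
  then have "prod_encode (l, k) \<notin> range (\<lambda>k. prod_encode (i, k))" by auto
  with False show ?thesis by (simp add: spread_off_range)
qed

section \<open>Operators that are blockwise multiples of a given operator\<close>

lemma (in vector_space) infinite_dimensionalI:
  assumes "infinite I" "inj_on f I" "independent (f ` I)" "f ` I \<subseteq> W"
  shows "infinite_dimensional scale W"
proof -
  have "infinite (f ` I)" using assms by (simp add: finite_image_iff)
  moreover have "finite (f ` I)" if "finite B" "W \<subseteq> span B" for B
    using independent_span_bound[OF that(1) assms(3)] assms(4) that(2) by blast
  ultimately show ?thesis by (auto simp: infinite_dimensional_def)
qed

locale operators_into_standard_seq_space =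
  operators_into_seq_space scaleV scaleX E nrm + E: standard_banach_seq_space scaleX E nrm
  for scaleV :: "'k::real_or_complex \<Rightarrow> 'v::banach \<Rightarrow> 'v"
    and scaleX :: "'k \<Rightarrow> 'x::banach \<Rightarrow> 'x"
    and E :: "(nat \<Rightarrow> 'x) set" and nrm :: "(nat \<Rightarrow> 'x) \<Rightarrow> real"
begin

sublocale L: normed_subspace "fun_scale (fun_scale scaleX)" L "operator_norm nrm"
  by (rule normed_space_operators)

lemma operator_norm_bound:
  assumes "R \<in> L"
  shows "nrm (R v) \<le> operator_norm nrm R * norm v"
proof -
  interpret R: Vector_Spaces.linear scaleV "fun_scale scaleX" R
    using assms by (rule operator_linear)
  show ?thesis
  proof (cases "v = 0")
    case True
    then show ?thesis
      using E.nrm_eq_0[OF E.subspace_0[OF E.subspace_M]] by (simp add: R.zero)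
  next
    case False
    define c :: 'k where "c = of_real (inverse (norm v))"
    have c: "norm c = inverse (norm v)" by (simp add: c_def norm_inverse)
    have "nrm (R (scaleV c v)) \<le> operator_norm nrm R"
      using assms False by (intro operator_norm_upper) (simp_all add: V.norm_scale c)
    then have "inverse (norm v) * nrm (R v) \<le> operator_norm nrm R"
      by (simp add: R.scale E.nrm_scale[OF operator_in_E[OF assms]] c)
    then show ?thesis using False by (simp add: field_simps)
  qed
qed

text \<open>The coordinate bound of a standard sequence space makes \<open>R \<mapsto> R v j\<close> a bounded
  \<open>X\<close>-valued linear map for the operator norm.\<close>

lemma coordinate_tendsto:
  assumes lim: "limitin (operator_topology scaleV scaleX E nrm) R S sequentially"
    and R: "\<And>m. R m \<in> L"
  shows "(\<lambda>m. R m v j) \<longlonglongrightarrow> S v j"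
proof -
  interpret M: Metric_space L "norm_dist L (operator_norm nrm)"
    by (rule L.Metric_space_norm_dist)
  obtain C where C: "C > 0" "\<And>x j. x \<in> E \<Longrightarrow> norm (x j) \<le> C * nrm x"
    using E.coordinate_bound by blast
  have S: "S \<in> L" and "(\<lambda>m. norm_dist L (operator_norm nrm) (R m) S) \<longlonglongrightarrow> 0"
    using lim unfolding operator_topology_def norm_topology_def M.limitin_metric_dist_null
    by auto
  then have "(\<lambda>m. operator_norm nrm (R m - S)) \<longlonglongrightarrow> 0"
    using R by (simp add: norm_dist_def)
  then have null: "(\<lambda>m. C * (operator_norm nrm (R m - S) * norm v)) \<longlonglongrightarrow> 0"
    by (intro tendsto_mult_right_zero tendsto_mult_left_zero)
  have "norm (R m v j - S v j) \<le> C * (operator_norm nrm (R m - S) * norm v)" for m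
  proof -
    have D: "R m - S \<in> L" using L.subspace_diff[OF L.subspace_M R S] .
    have "norm ((R m - S) v j) \<le> C * nrm ((R m - S) v)"
      by (rule C(2)[OF operator_in_E[OF D]])
    also have "\<dots> \<le> C * (operator_norm nrm (R m - S) * norm v)"
      using operator_norm_bound[OF D] C(1) by (intro mult_left_mono) auto
    finally show ?thesis by simp
  qed
  then have "(\<lambda>m. R m v j - S v j) \<longlonglongrightarrow> 0"
    by (intro Lim_null_comparison[OF always_eventually null] allI)
  then show ?thesis by (simp add: LIM_zero_iff)
qed

definition block_multiples :: "('v \<Rightarrow> nat \<Rightarrow> 'x) \<Rightarrow> ('v \<Rightarrow> nat \<Rightarrow> 'x) set" where
  "block_multiples T =
     {R \<in> L. \<forall>i. \<exists>a. \<forall>v k. R v (prod_encode (i, k)) = scaleX a (T v k)}"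

lemma subspace_block_multiples: "L.subspace (block_multiples T)"
proof (rule L.subspaceI)
  have "\<forall>v k. (0 :: 'v \<Rightarrow> nat \<Rightarrow> 'x) v (prod_encode (i, k)) = scaleX 0 (T v k)" for i
    by simp
  then show "0 \<in> block_multiples T"
    using L.subspace_0[OF L.subspace_M] unfolding block_multiples_def by blast
next
  fix R S assume R: "R \<in> block_multiples T" and S: "S \<in> block_multiples T"
  have "\<exists>c. \<forall>v k. (R + S) v (prod_encode (i, k)) = scaleX c (T v k)" for i
  proof -
    obtain a where "\<forall>v k. R v (prod_encode (i, k)) = scaleX a (T v k)"
      using R unfolding block_multiples_def by blast
    moreover obtain b where "\<forall>v k. S v (prod_encode (i, k)) = scaleX b (T v k)"
      using S unfolding block_multiples_def by blast
    ultimately show ?thesis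
      by (intro exI[of _ "a + b"]) (simp add: E.X.scale_left_distrib)
  qed
  then show "R + S \<in> block_multiples T"
    using R S L.subspace_add[OF L.subspace_M] unfolding block_multiples_def by blast
next
  fix c R assume R: "R \<in> block_multiples T"
  have "\<exists>b. \<forall>v k. fun_scale (fun_scale scaleX) c R v (prod_encode (i, k)) = scaleX b (T v k)" for i
  proof -
    obtain a where "\<forall>v k. R v (prod_encode (i, k)) = scaleX a (T v k)"
      using R unfolding block_multiples_def by blast
    then show ?thesis
      by (intro exI[of _ "c * a"]) (simp add: fun_scale_def)
  qed
  then show "fun_scale (fun_scale scaleX) c R \<in> block_multiples T"
    using R L.subspace_scale[OF L.subspace_M] unfolding block_multiples_def by blast
qed

lemma block_multiples_injective:
  assumes T: "T \<in> L" "inj T" and R: "R \<in> block_multiples T" "R \<noteq> 0"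
  shows "R \<in> injective_operators scaleV scaleX E nrm"
proof -
  have RL: "R \<in> L" using R(1) by (simp add: block_multiples_def)
  interpret T: Vector_Spaces.linear scaleV "fun_scale scaleX" T
    using T(1) by (rule operator_linear)
  interpret R: Vector_Spaces.linear scaleV "fun_scale scaleX" R
    using RL by (rule operator_linear)
  obtain w j where wj: "R w j \<noteq> 0"
    using R(2) by (auto simp: fun_eq_iff)
  \<comment> \<open>The block on which \<open>R w\<close> does not vanish carries a nonzero multiple of \<open>T\<close>.\<close>
  obtain i l where j: "j = prod_encode (i, l)"
    by (metis prod_decode_inverse surj_pair)
  obtain a where a: "\<And>v k. R v (prod_encode (i, k)) = scaleX a (T v k)"
    using R(1) unfolding block_multiples_def by blast
  have "a \<noteq> 0" using wj a j by auto
  have "v = 0" if "R v = 0" for v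
  proof -
    have "T v k = 0" for k
      using a[of v k] that \<open>a \<noteq> 0\<close> by simp
    then have "T v = T 0" by (simp add: T.zero fun_eq_iff)
    with T(2) show ?thesis by (rule injD)
  qed
  then have "inj R"
    by (metis R.diff eq_iff_diff_eq_0 injI)
  with RL show ?thesis by (simp add: injective_operators_def)
qed

lemma closedin_block_multiples:
  "closedin (operator_topology scaleV scaleX E nrm) (block_multiples T)"
proof -
  interpret M: Metric_space L "norm_dist L (operator_norm nrm)"
    by (rule L.Metric_space_norm_dist)
  have "S \<in> block_multiples T"
    if R: "range R \<subseteq> block_multiples T" and lim: "limitin M.mtopology R S sequentially" for R S
  proof -
    have RL: "R m \<in> L" for m using R by (auto simp: block_multiples_def)
    have conv: "(\<lambda>m. R m v j) \<longlonglongrightarrow> S v j" for v j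
      using lim RL by (intro coordinate_tendsto) (simp_all add: operator_topology_def norm_topology_def)
    have "\<exists>b. \<forall>v k. S v (prod_encode (i, k)) = scaleX b (T v k)" for i
    proof -
      have "\<forall>m. \<exists>a. \<forall>v k. R m v (prod_encode (i, k)) = scaleX a (T v k)"
        using R unfolding block_multiples_def by blast
      then obtain a where a: "\<And>m v k. R m v (prod_encode (i, k)) = scaleX (a m) (T v k)"
        by metis
      \<comment> \<open>One scalar must serve all \<open>v\<close> and \<open>k\<close> at once, so the family is indexed by pairs.\<close>
      have "\<exists>b. \<forall>p. S (fst p) (prod_encode (i, snd p)) = scaleX b (T (fst p) (snd p))"
        by (rule E.X.limit_of_multiples[where a=a]) (simp add: conv flip: a)
      then show ?thesis by auto
    qed
    then show ?thesis
      using M.limitin_mspace[OF lim] by (simp add: block_multiples_def)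
  qed
  moreover have "block_multiples T \<subseteq> L"
    by (simp add: block_multiples_def)
  ultimately show ?thesis
    unfolding operator_topology_def norm_topology_def M.metric_closedin_iff_sequentially_closed
    by blast
qed

text \<open>Copying \<open>T\<close> onto a single block gives operators that are independent, because a coordinate
  inside the \<open>i\<close>-th block vanishes on the span of all copies other than the \<open>i\<close>-th.\<close>

lemma infinite_dimensional_block_multiples:
  assumes T: "T \<in> L" "T \<noteq> 0"
  shows "infinite_dimensional (fun_scale (fun_scale scaleX)) (block_multiples T)"
proof -
  interpret T: Vector_Spaces.linear scaleV "fun_scale scaleX" T
    using T(1) by (rule operator_linear)
  define copy where "copy i v = spread (\<lambda>k. prod_encode (i, k)) (T v)" for i v
  have copy: "copy i v (prod_encode (l, k)) = (if l = i then T v k else 0)" for i l v k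
    by (simp add: copy_def spread_prod_encode)
  have blockwise_eqI: "x = y" if eq: "\<And>l k. x (prod_encode (l, k)) = y (prod_encode (l, k))"
    for x y :: "nat \<Rightarrow> 'x"
  proof
    fix j
    show "x j = y j"
      using eq[of "fst (prod_decode j)" "snd (prod_decode j)"] by simp
  qed
  have copy_L: "copy i \<in> L" for i
  proof -
    obtain B where B: "\<And>v. nrm (T v) \<le> B * norm v"
      using operator_bounded[OF T(1)] by metis
    have spread: "copy i v \<in> E \<and> nrm (copy i v) \<le> nrm (T v)" for v
      unfolding copy_def
      by (rule E.spread_closed[OF operator_in_E[OF T(1)] strict_mono_prod_encode])
    show ?thesis
    proof (rule operatorI[where B=B])
      show "Vector_Spaces.linear scaleV (fun_scale scaleX) (copy i)"
      proof (unfold_locales)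
        show "copy i (v + w) = copy i v + copy i w" for v w
          by (rule blockwise_eqI) (simp add: copy T.add)
        show "copy i (scaleV c v) = fun_scale scaleX c (copy i v)" for c v
          by (rule blockwise_eqI) (simp add: copy T.scale fun_scale_def)
      qed
      show "copy i v \<in> E" "nrm (copy i v) \<le> B * norm v" for v
        using spread[of v] B[of v] by auto
    qed
  qed
  have "\<exists>a. \<forall>v k. copy i v (prod_encode (l, k)) = scaleX a (T v k)" for i l
    by (intro exI[of _ "if l = i then 1 else 0"]) (simp add: copy)
  then have in_W: "range copy \<subseteq> block_multiples T"
    using copy_L unfolding block_multiples_def by blast
  obtain v k where vk: "T v k \<noteq> 0"
    using T(2) by (auto simp: fun_eq_iff)
  have separate: "copy i \<noteq> copy l" if "i \<noteq> l" for i l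
    using copy[of i v i k] copy[of l v i k] that vk by auto
  have "copy i \<notin> L.span (range copy - {copy i})" for i
  proof
    let ?H = "{R. R v (prod_encode (i, k)) = 0}"
    assume "copy i \<in> L.span (range copy - {copy i})"
    moreover have "L.span (range copy - {copy i}) \<subseteq> ?H"
    proof (rule L.span_minimal)
      show "range copy - {copy i} \<subseteq> ?H" by (auto simp: copy)
      show "L.subspace ?H" by (rule L.subspaceI) (simp_all add: fun_scale_def)
    qed
    ultimately show False using vk by (auto simp: copy)
  qed
  then have "L.independent (range copy)"
    by (auto simp: L.dependent_def)
  moreover have "inj copy" using separate by (meson injI)
  ultimately show ?thesis
    using in_W by (intro L.infinite_dimensionalI[where I=UNIV]) auto
qed

end

section \<open>Spaceability of the injective operators\<close>

theorem theorem1p3: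
  fixes scaleV :: "'k::real_or_complex \<Rightarrow> 'v::banach \<Rightarrow> 'v"
    and scaleX :: "'k \<Rightarrow> 'x::banach \<Rightarrow> 'x"
    and E :: "(nat \<Rightarrow> 'x) set" and nrm :: "(nat \<Rightarrow> 'x) \<Rightarrow> real"
  assumes "banach_space_over scaleV"
    and "infinite_dimensional scaleV UNIV"
    and "standard_banach_seq_space scaleX E nrm"
  shows "injective_operators scaleV scaleX E nrm = {} \<or>
    spaceable (fun_scale (fun_scale scaleX)) (operator_topology scaleV scaleX E nrm)
      (injective_operators scaleV scaleX E nrm)"
proof (cases "injective_operators scaleV scaleX E nrm = {}")
  case False
  interpret V: banach_space_over scaleV by fact
  interpret E: standard_banach_seq_space scaleX E nrm by fact
  interpret operators_into_standard_seq_space scaleV scaleX E nrm ..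
  obtain T where T: "T \<in> L" "inj T"
    using False by (auto simp: injective_operators_def)
  have "T \<noteq> 0"
  proof
    assume "T = 0"
    with T(2) have "v = 0" for v :: 'v by (simp add: inj_def)
    then have "UNIV \<subseteq> V.span ({} :: 'v set)" by auto
    with assms(2) show False
      unfolding infinite_dimensional_def using finite.emptyI by blast
  qed
  with T have "infinite_dimensional (fun_scale (fun_scale scaleX)) (block_multiples T)"
    by (intro infinite_dimensional_block_multiples)
  moreover have "block_multiples T \<subseteq> injective_operators scaleV scaleX E nrm \<union> {0}"
    using block_multiples_injective[OF T] by blast
  ultimately show ?thesis
    unfolding spaceable_def
    by (intro disjI2 exI[of _ "block_multiples T"] conjI
        subspace_block_multiples closedin_block_multiples)
qed simp

end
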